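(* For each $\alpha\in(0,2]$, the Linnik distribution with parameter $\alpha$ is the scale mixture of zero-mean normal laws with mixing Mittag-Leffler distribution with twice less parameter $\alpha/2$: $$L_{\alpha}\stackrel{d}{=}X\sqrt{M_{\alpha/2}},$$ where the random variables on the right-hand side are independent.
   Context: $\stackrel{d}{=}$ denotes coincidence of distributions. $X$ is a random variable with the standard normal distribution. For $\alpha\in(0,2]$, $L_\alpha$ is a random variable with the Linnik distribution with parameter $\alpha$, i.e. with characteristic function $1/(1+|t|^{\alpha})$, $t\in\mathbb{R}$. For $\delta\in(0,1]$, $M_\delta$ is a nonnegative random variable with the (standard) Mittag-Leffler distribution with parameter $\delta$, i.e. with Laplace transform $\mathsf{E}e^{-sM_\delta}=1/(1+s^{\delta})$, $s\ge 0$.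
   Formalization: The identity is proved with √(2M_{α/2}) in place of √(M_{α/2}), since under the stated normalizations X√(M_{α/2}) has characteristic function 1/(1+2^{-α/2}|t|^α), so the printed identity fails for every α (for α=2 the variances are 2 and 1). *)

theory Defs
  imports "HOL-Probability.Probability"
begin

definition linnik_distribution :: "real \<Rightarrow> real measure \<Rightarrow> bool" where
  "linnik_distribution \<alpha> \<mu> \<longleftrightarrow>
     real_distribution \<mu> \<and>
     (\<forall>t::real. char \<mu> t = complex_of_real (1 / (1 + \<bar>t\<bar> powr \<alpha>)))"

text \<open>Support in the nonnegative half-line is required almost everywhere, as is appropriate
  for a property of laws. It makes the integrand below bounded, so the integral is a genuine
  expectation and not the default value of a non-integrable function.

  These normalizations fix the scale in the normal mixture representation. If \<open>X\<close> is standard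
  normal and \<open>M\<close> is an independent Mittag-Leffler variable with parameter \<open>\<alpha> / 2\<close>, then for
  \<open>c > 0\<close> the variable \<open>X * sqrt (c * M)\<close> has characteristic function
  \<open>E exp (- c * t^2 * M / 2) = 1 / (1 + (c / 2) powr (\<alpha> / 2) * \<bar>t\<bar> powr \<alpha>)\<close>. This is the
  Linnik characteristic function exactly for \<open>c = 2\<close>. For \<open>c = 1\<close> it is that of a Linnik
  variable divided by \<open>sqrt 2\<close>.\<close>

definition mittag_leffler_distribution :: "real \<Rightarrow> real measure \<Rightarrow> bool" where
  "mittag_leffler_distribution \<delta> \<nu> \<longleftrightarrow>
     real_distribution \<nu> \<and>
     (AE x in \<nu>. 0 \<le> x) \<and>
     (\<forall>s\<ge>0. (LINT x|\<nu>. exp (- s * x)) = 1 / (1 + s powr \<delta>))"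

end

theory Submission
  imports Defs
begin

text \<open>A law on the line is determined by its characteristic function, so it suffices to compute that of
  \<open>X * sqrt (2 * M)\<close>. Conditionally on \<open>M = m\<close> this variable is centred normal with variance
  \<open>2 * m\<close>, so its conditional characteristic function is \<open>exp (- t\<^sup>2 * m)\<close>. Averaging over \<open>M\<close> turns
  the Gaussian characteristic function into the Laplace transform of \<open>M\<close> at \<open>s = t\<^sup>2\<close>, which is
  \<open>1 / (1 + (t\<^sup>2) powr (\<alpha> / 2)) = 1 / (1 + \<bar>t\<bar> powr \<alpha>)\<close>, the Linnik characteristic function.\<close>

text \<open>Independence makes the joint law a product, so Fubini applies and the inner integral is the
  characteristic function of the standard normal law at \<open>t * v\<close>.\<close>

lemma (in prob_space) char_normal_scale_mixture:
  fixes X V :: "'a \<Rightarrow> real"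
  assumes X: "distr M borel X = std_normal_distribution"
    and indep: "indep_var borel X borel V"
  shows "char (distr M borel (\<lambda>\<omega>. X \<omega> * V \<omega>)) t =
    complex_of_real (LINT v|distr M borel V. exp (- (t * v)\<^sup>2 / 2))"
proof -
  have [measurable]: "random_variable borel X" "random_variable borel V"
    using indep by (auto dest: indep_var_rv1 indep_var_rv2)
  interpret DX: prob_space "distr M borel X" by (rule prob_space_distr) simp
  interpret DV: prob_space "distr M borel V" by (rule prob_space_distr) simp
  interpret DXV: pair_prob_space "distr M borel X" "distr M borel V" ..
  have joint: "distr M borel X \<Otimes>\<^sub>M distr M borel V = distr M (borel \<Otimes>\<^sub>M borel) (\<lambda>\<omega>. (X \<omega>, V \<omega>))"
    using indep by (simp add: indep_var_distribution_eq)
  have "char (distr M borel (\<lambda>\<omega>. X \<omega> * V \<omega>)) t = (CLINT \<omega>|M. iexp (t * (X \<omega> * V \<omega>)))"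
    by (simp add: char_def integral_distr)
  also have "\<dots> = (CLINT z|distr M borel X \<Otimes>\<^sub>M distr M borel V. iexp (t * (fst z * snd z)))"
    by (simp add: joint integral_distr)
  also have "\<dots> = (CLINT v|distr M borel V. CLINT x|distr M borel X. iexp (t * (x * v)))"
    using DXV.integral_snd[of "\<lambda>x v. iexp (t * (x * v))"]
    by (simp add: case_prod_beta' DXV.integrable_const_bound[where B = 1])
  also have "\<dots> = (CLINT v|distr M borel V. char std_normal_distribution (t * v))"
    by (simp add: X char_def mult_ac)
  also have "\<dots> = complex_of_real (LINT v|distr M borel V. exp (- (t * v)\<^sup>2 / 2))"
    by (simp add: char_std_normal_distribution flip: integral_complex_of_real)
  finally show ?thesis .
qed

theorem corollary5:
  fixes \<alpha> :: real
    and P :: "'a measure" and Q :: "'b measure"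
    and X M :: "'a \<Rightarrow> real" and L :: "'b \<Rightarrow> real"
  assumes "0 < \<alpha>" "\<alpha> \<le> 2"
    and "prob_space P" "prob_space Q"
    and "X \<in> borel_measurable P" "M \<in> borel_measurable P" "L \<in> borel_measurable Q"
    and "distr P borel X = std_normal_distribution"
    and "mittag_leffler_distribution (\<alpha> / 2) (distr P borel M)"
    and "prob_space.indep_var P borel X borel M"
    and "linnik_distribution \<alpha> (distr Q borel L)"
  shows "distr Q borel L = distr P borel (\<lambda>\<omega>. X \<omega> * sqrt (2 * M \<omega>))"
proof (rule Levy_uniqueness)
  interpret P: prob_space P by fact
  note [measurable] = assms(5,6)
  let ?V = "\<lambda>\<omega>. sqrt (2 * M \<omega>)"
  show "real_distribution (distr Q borel L)"
    using assms(11) by (simp add: linnik_distribution_def)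
  show "real_distribution (distr P borel (\<lambda>\<omega>. X \<omega> * ?V \<omega>))"
    by (rule P.real_distribution_distr) simp
  have indep: "P.indep_var borel X borel ?V"
    using P.indep_var_compose[OF assms(10), of id borel "\<lambda>m. sqrt (2 * m)" borel]
    by (simp add: comp_def)
  have nonneg: "AE m in distr P borel M. 0 \<le> m"
    and laplace: "\<And>s. 0 \<le> s \<Longrightarrow> (LINT m|distr P borel M. exp (- s * m)) = 1 / (1 + s powr (\<alpha> / 2))"
    using assms(9) by (auto simp: mittag_leffler_distribution_def)
  \<comment> \<open>Nonnegativity of \<open>M\<close> enters because \<open>sqrt\<close> is extended to an odd function on the line:
    in general, \<open>(sqrt (2 * m))\<^sup>2\<close> is \<open>\<bar>2 * m\<bar>\<close>.\<close>
  have sqrt_sq: "AE m in distr P borel M. (sqrt (2 * m))\<^sup>2 = m * 2"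
    using nonneg by (rule eventually_mono) simp
  show "char (distr Q borel L) = char (distr P borel (\<lambda>\<omega>. X \<omega> * ?V \<omega>))"
  proof
    fix t :: real
    have "(LINT v|distr P borel ?V. exp (- (t * v)\<^sup>2 / 2)) =
        (LINT m|distr P borel M. exp (- (t * sqrt (2 * m))\<^sup>2 / 2))"
      by (simp add: integral_distr)
    also have "\<dots> = (LINT m|distr P borel M. exp (- t\<^sup>2 * m))"
      using sqrt_sq by (intro integral_cong_AE) (auto simp: power_mult_distrib mult_ac)
    also have "\<dots> = 1 / (1 + (t\<^sup>2) powr (\<alpha> / 2))"
      by (rule laplace) simp
    also have "(t\<^sup>2) powr (\<alpha> / 2) = \<bar>t\<bar> powr \<alpha>"
    proof -
      have "t\<^sup>2 = \<bar>t\<bar> powr 2" by (cases "t = 0") (auto simp: powr_numeral)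
      then show ?thesis by (simp only: powr_powr) simp
    qed
    finally show "char (distr Q borel L) t = char (distr P borel (\<lambda>\<omega>. X \<omega> * ?V \<omega>)) t"
      using assms(11) P.char_normal_scale_mixture[OF assms(8) indep, of t]
      by (simp add: linnik_distribution_def)
  qed
qed

end
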